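(* Let $\Phi=\{\phi_1,\ldots,\phi_N\}$, $N\ge2$, be an iterated function system of contracting similarities of $\mathbb{R}$ satisfying the open set condition, let $F\subseteq\mathbb{R}$ be the self-similar set generated by $\Phi$, and let $I$ be the interior of the convex hull of $F$. Then there exists a strong and compatible feasible open set $U$ for $\Phi$, i.e. a feasible open set $U$ for $\Phi$ with $U\cap F\neq\emptyset$ and $\partial U\subseteq F$. Moreover, there always exists such a set $U$ that is generated from a finite union of intervals $\phi_u(I)$: there exist $m\in\mathbb{N}_0$ and $\Lambda\subseteq\Sigma^m$ such that $$U_\Lambda:=\bigcup_{\omega\in\Sigma^*}\phi_\omega\Big(\bigcup_{u\in\Lambda}\phi_u(I)\Big)$$ is a strong and compatible feasible open set for $\Phi$.
   Context: Let $\Phi=\{\phi_1,\ldots,\phi_N\}$ be an iterated function system (IFS) consisting of $N\ge 2$ contracting similarities $\phi_i:\mathbb{R}\to\mathbb{R}$, and let $\Sigma=\{1,\ldots,N\}$. A feasible open set for $\Phi$ is a nonempty open set $O\subseteq\mathbb{R}$ with $\phi_i(O)\subseteq O$ for all $i\in\Sigma$ and $\phi_i(O)\cap\phi_j(O)=\emptyset$ for all $i\neq j$ in $\Sigma$. $\Phi$ satisfies the open set condition (OSC) if a feasible open set for $\Phi$ exists. The self-similar set generated by $\Phi$ is the unique nonempty compact set $F\subseteq\mathbb{R}$ with $F=\bigcup_{i\in\Sigma}\phi_i(F)$. It is well known that under OSC $F$ has more than one point, so $I$ is a nonempty open interval, and $\overline{I}$ is the smallest closed interval containing $F$. A feasible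 open set $O$ is called strong if $O\cap F\neq\emptyset$, and compatible if $\partial O\subseteq F$, where $\partial O$ is the topological boundary of $O$. $\Sigma^*=\bigcup_{n=0}^\infty\Sigma^n$ is the set of finite words over $\Sigma$, where $\Sigma^0$ consists of the empty word only. For $\omega=(\omega_1,\ldots,\omega_n)\in\Sigma^*$, $\phi_\omega=\phi_{\omega_1}\circ\cdots\circ\phi_{\omega_n}$, and for the empty word $\phi_\omega$ is the identity map. $\mathbb{N}_0=\{0,1,2,\ldots\}$. *)

theory Defs
  imports "HOL-Analysis.Analysis"
begin

definition contracting_similarity :: "(real \<Rightarrow> real) \<Rightarrow> bool" where
  "contracting_similarity f \<longleftrightarrow>
     (\<exists>r. 0 < r \<and> r < 1 \<and> (\<forall>x y. dist (f x) (f y) = r * dist x y))"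

(* An IFS of N maps is a family phi indexed by nat, of which only the values at
   the indices 1, ..., N are ever used. *)

definition similarity_ifs :: "nat \<Rightarrow> (nat \<Rightarrow> real \<Rightarrow> real) \<Rightarrow> bool" where
  "similarity_ifs N \<phi> \<longleftrightarrow> 2 \<le> N \<and> (\<forall>i\<in>{1..N}. contracting_similarity (\<phi> i))"

definition feasible_open_set :: "nat \<Rightarrow> (nat \<Rightarrow> real \<Rightarrow> real) \<Rightarrow> real set \<Rightarrow> bool" where
  "feasible_open_set N \<phi> U \<longleftrightarrow>
     open U \<and> U \<noteq> {} \<and>
     (\<forall>i\<in>{1..N}. \<phi> i ` U \<subseteq> U) \<and>
     (\<forall>i\<in>{1..N}. \<forall>j\<in>{1..N}. i \<noteq> j \<longrightarrow> \<phi> i ` U \<inter> \<phi> j ` U = {})"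

definition open_set_condition :: "nat \<Rightarrow> (nat \<Rightarrow> real \<Rightarrow> real) \<Rightarrow> bool" where
  "open_set_condition N \<phi> \<longleftrightarrow> (\<exists>U. feasible_open_set N \<phi> U)"

(* For a similarity IFS exactly one set F has this property (Hutchinson), so it
   is used as a predicate on F rather than through a definite description. *)

definition self_similar_set :: "nat \<Rightarrow> (nat \<Rightarrow> real \<Rightarrow> real) \<Rightarrow> real set \<Rightarrow> bool" where
  "self_similar_set N \<phi> F \<longleftrightarrow> compact F \<and> F \<noteq> {} \<and> F = (\<Union>i\<in>{1..N}. \<phi> i ` F)"

definition strong_set :: "real set \<Rightarrow> real set \<Rightarrow> bool" where
  "strong_set F U \<longleftrightarrow> U \<inter> F \<noteq> {}"

definition compatible_set :: "real set \<Rightarrow> real set \<Rightarrow> bool" where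
  "compatible_set F U \<longleftrightarrow> frontier U \<subseteq> F"

definition words_of_length :: "nat \<Rightarrow> nat \<Rightarrow> nat list set" where
  "words_of_length N n = {w. set w \<subseteq> {1..N} \<and> length w = n}"

definition words :: "nat \<Rightarrow> nat list set" where
  "words N = (\<Union>n. words_of_length N n)"

definition word_map :: "(nat \<Rightarrow> real \<Rightarrow> real) \<Rightarrow> nat list \<Rightarrow> real \<Rightarrow> real" where
  "word_map \<phi> w = foldr (\<circ>) (map \<phi> w) id"

definition central_interval :: "real set \<Rightarrow> real set" where
  "central_interval F = interior (convex hull F)"

definition generated_set ::
  "nat \<Rightarrow> (nat \<Rightarrow> real \<Rightarrow> real) \<Rightarrow> real set \<Rightarrow> nat list set \<Rightarrow> real set" where
  "generated_set N \<phi> F \<Lambda> =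
     (\<Union>w\<in>words N. word_map \<phi> w ` (\<Union>u\<in>\<Lambda>. word_map \<phi> u ` central_interval F))"

end

theory Submission
  imports Defs "HOL-Library.Sublist"
begin

text \<open>
  The heart of the matter is that the open set condition can be improved to a feasible open set
  meeting \<open>F\<close>; everything else about \<open>U\<^sub>\<Lambda>\<close> is then nearly automatic.

  \<^bold>\<open>From open set to strong open set.\<close>  This is Schief's argument.  Attach to a word \<open>\<kappa>\<close> its
  neighbours: the words \<open>v\<close> whose cylinder \<open>\<phi>\<^sub>v(F)\<close> has about the same size as \<open>\<phi>\<^sub>\<kappa>(F)\<close> and comes close
  to a marked point \<open>\<phi>\<^sub>\<kappa>(p)\<close>, both measured in the scale of \<open>\<phi>\<^sub>\<kappa>\<close>.  Since distinct neighbours are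
  incomparable, the open set condition keeps them apart, and a packing argument bounds their number
  uniformly in \<open>\<kappa>\<close> (\<open>card_neighbours_bounded\<close>).  Prefixing a word \<open>\<omega>\<close> turns neighbours of \<open>\<kappa>\<close> into
  neighbours of \<open>\<omega>\<kappa>\<close>, so if \<open>\<kappa>\<close> has as many neighbours as possible, then \<open>\<omega>\<kappa>\<close> has no others: all
  its neighbours begin with \<open>\<omega>\<close>.  In particular no cylinder of about the size of \<open>\<phi>\<^sub>i\<^sub>\<omega>\<^sub>\<kappa>(F)\<close> whose word
  starts with \<open>j \<noteq> i\<close> comes close to \<open>\<phi>\<^sub>i\<^sub>\<omega>\<^sub>\<kappa>(p)\<close>, so the orbit of a small ball around \<open>\<phi>\<^sub>\<kappa>(p) \<in> F\<close> is a strong feasible open set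
  (\<open>strong_feasible_open_set_exists\<close>).

  \<^bold>\<open>From strong to compatible.\<close>  If \<open>V\<close> is strong, some cylinder interval \<open>\<phi>\<^sub>u(I)\<close> lies inside \<open>V\<close>, and
  a single word suffices: \<open>\<Lambda> = {u}\<close>.  The set \<open>U\<^sub>\<Lambda>\<close> is invariant by construction and inherits the
  disjointness of the images from \<open>V \<supseteq> U\<^sub>\<Lambda>\<close>.  It is a union of open intervals \<open>\<phi>\<^sub>w(I)\<close> with end points
  in \<open>F\<close>, and the boundary of any such union lies in the closed set \<open>F\<close>: an interval that misses a
  point outside \<open>F\<close> also misses the part of the complement of \<open>F\<close> near this point.  Finally \<open>I\<close> meets
  \<open>F\<close> because a contraction cannot map a two-point set into itself injectively.
\<close>

section \<open>Words and similarities of the line\<close>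

lemma words_iff: "w \<in> words N \<longleftrightarrow> set w \<subseteq> {1..N}"
  by (auto simp: words_def words_of_length_def)

lemma word_map_Nil [simp]: "word_map \<phi> [] = id"
  by (simp add: word_map_def)

lemma word_map_Cons [simp]: "word_map \<phi> (i # w) x = \<phi> i (word_map \<phi> w x)"
  by (simp add: word_map_def)

lemma word_map_append: "word_map \<phi> (v @ w) x = word_map \<phi> v (word_map \<phi> w x)"
  by (induction v) auto

text \<open>
  On the line, knowing the distances of \<open>f x\<close> to \<open>f 0\<close> and to \<open>f 1\<close> determines \<open>f x\<close>, because the two
  equations differ by a linear one.
\<close>

lemma contracting_similarity_affine:
  assumes "contracting_similarity f"
  obtains a where "0 < \<bar>a\<bar>" "\<bar>a\<bar> < 1" "\<And>x. f x = a * x + f 0"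
proof -
  obtain r where r: "0 < r" "r < 1" "\<And>x y. \<bar>f x - f y\<bar> = r * \<bar>x - y\<bar>"
    using assms by (auto simp: contracting_similarity_def dist_real_def)
  define a where "a = f 1 - f 0"
  have abs_a: "\<bar>a\<bar> = r" using r(3)[of 1 0] by (simp add: a_def)
  have sq: "(f x - f y)\<^sup>2 = r\<^sup>2 * (x - y)\<^sup>2" for x y
    using arg_cong[OF r(3)[of x y], of "\<lambda>t. t\<^sup>2"] by (simp add: power_mult_distrib)
  have a2: "a\<^sup>2 = r\<^sup>2" using abs_a by (metis power2_abs)
  have "f x = a * x + f 0" for x
  proof -
    define g where "g = f x - f 0"
    have "2 * (a * g) = g\<^sup>2 + a\<^sup>2 - (g - a)\<^sup>2"
      by (simp add: power2_eq_square algebra_simps)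
    also have "\<dots> = a\<^sup>2 * x\<^sup>2 + a\<^sup>2 - a\<^sup>2 * (x - 1)\<^sup>2"
      using sq[of x 0] sq[of x 1] by (simp add: g_def a_def a2[unfolded a_def])
    also have "\<dots> = 2 * (a * (a * x))"
      by (simp add: power2_eq_square algebra_simps)
    finally have "a * (g - a * x) = 0" by (simp add: algebra_simps)
    then have "g = a * x" using abs_a r(1) by auto
    then show ?thesis by (simp add: g_def)
  qed
  then show thesis using that[of a] abs_a r(1,2) by blast
qed

locale affine_ifs =
  fixes N :: nat and \<phi> :: "nat \<Rightarrow> real \<Rightarrow> real" and a :: "nat \<Rightarrow> real"
  assumes two_le_N: "2 \<le> N"
    and slope_pos: "i \<in> {1..N} \<Longrightarrow> 0 < \<bar>a i\<bar>"
    and slope_less_1: "i \<in> {1..N} \<Longrightarrow> \<bar>a i\<bar> < 1"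
    and affine: "i \<in> {1..N} \<Longrightarrow> \<phi> i x = a i * x + \<phi> i 0"
begin

definition slope :: "nat list \<Rightarrow> real" where
  "slope w = prod_list (map a w)"

lemma slope_Nil [simp]: "slope [] = 1"
  and slope_Cons [simp]: "slope (i # w) = a i * slope w"
  and slope_append [simp]: "slope (v @ w) = slope v * slope w"
  by (simp_all add: slope_def)

lemma slope_word_pos: "w \<in> words N \<Longrightarrow> 0 < \<bar>slope w\<bar>"
proof (induction w)
  case (Cons i w)
  then show ?case using slope_pos[of i] by (auto simp: words_iff abs_mult)
qed simp

lemma slope_word_le_1: "w \<in> words N \<Longrightarrow> \<bar>slope w\<bar> \<le> 1"
proof (induction w)
  case (Cons i w)
  then show ?case using slope_less_1[of i] mult_mono[of "\<bar>a i\<bar>" 1 "\<bar>slope w\<bar>" 1]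
    by (auto simp: words_iff abs_mult)
qed simp

lemma slope_Cons_less_1: "i # w \<in> words N \<Longrightarrow> \<bar>slope (i # w)\<bar> < 1"
  using slope_word_le_1[of w] slope_less_1[of i] mult_left_le[of "\<bar>slope w\<bar>" "\<bar>a i\<bar>"]
  by (simp add: words_iff abs_mult)

lemma word_map_affine: "w \<in> words N \<Longrightarrow> word_map \<phi> w x = slope w * x + word_map \<phi> w 0"
proof (induction w arbitrary: x)
  case (Cons i w)
  then have i: "i \<in> {1..N}" and w: "w \<in> words N" by (auto simp: words_iff)
  show ?case
    using affine[OF i, of "word_map \<phi> w x"] affine[OF i, of "word_map \<phi> w 0"] Cons.IH[OF w, of x]
    by (simp add: algebra_simps)
qed simp

lemma word_map_diff: "w \<in> words N \<Longrightarrow> word_map \<phi> w x - word_map \<phi> w y = slope w * (x - y)"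
  using word_map_affine[of w x] word_map_affine[of w y] by (simp add: algebra_simps)

lemma abs_word_map_diff:
  "w \<in> words N \<Longrightarrow> \<bar>word_map \<phi> w x - word_map \<phi> w y\<bar> = \<bar>slope w\<bar> * \<bar>x - y\<bar>"
  by (simp add: word_map_diff abs_mult)

lemma inj_word_map: "w \<in> words N \<Longrightarrow> inj (word_map \<phi> w)"
  by (rule injI) (metis word_map_diff slope_word_pos abs_zero less_irrefl mult_eq_0_iff
      diff_self right_minus_eq)

lemma ball_word_map:
  assumes w: "w \<in> words N"
  shows "word_map \<phi> w ` ball x e = ball (word_map \<phi> w x) (\<bar>slope w\<bar> * e)"
proof
  show "word_map \<phi> w ` ball x e \<subseteq> ball (word_map \<phi> w x) (\<bar>slope w\<bar> * e)"
    using slope_word_pos[OF w] by (auto simp: dist_real_def abs_word_map_diff[OF w])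
  show "ball (word_map \<phi> w x) (\<bar>slope w\<bar> * e) \<subseteq> word_map \<phi> w ` ball x e"
  proof
    fix y assume y: "y \<in> ball (word_map \<phi> w x) (\<bar>slope w\<bar> * e)"
    define z where "z = (y - word_map \<phi> w 0) / slope w"
    have yz: "y = word_map \<phi> w z"
      using slope_word_pos[OF w] by (subst word_map_affine[OF w]) (simp add: z_def)
    then have "z \<in> ball x e"
      using y slope_word_pos[OF w] by (simp add: dist_real_def abs_word_map_diff[OF w])
    with yz show "y \<in> word_map \<phi> w ` ball x e" by blast
  qed
qed

lemma open_word_map_image:
  assumes w: "w \<in> words N" and S: "open S"
  shows "open (word_map \<phi> w ` S)"
proof -
  have "word_map \<phi> w ` S = (\<lambda>x. word_map \<phi> w 0 + slope w *\<^sub>R x) ` S"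
    by (rule image_cong[OF refl], subst word_map_affine[OF w]) simp
  with open_affinity[OF S, of "slope w" "word_map \<phi> w 0"] slope_word_pos[OF w]
  show ?thesis by auto
qed

lemma word_map_interval:
  assumes w: "w \<in> words N" and "c < d"
  shows "word_map \<phi> w ` {c<..<d} =
    {min (word_map \<phi> w c) (word_map \<phi> w d) <..< max (word_map \<phi> w c) (word_map \<phi> w d)}"
proof -
  have "x \<in> {c<..<d} \<longleftrightarrow> x \<in> ball ((c + d) / 2) ((d - c) / 2)" for x
    unfolding mem_ball dist_real_def greaterThanLessThan_iff abs_less_iff by (auto simp: field_simps)
  then have "{c<..<d} = ball ((c + d) / 2) ((d - c) / 2)" by blast
  then have im: "word_map \<phi> w ` {c<..<d} =
      ball (word_map \<phi> w ((c + d) / 2)) (\<bar>slope w\<bar> * ((d - c) / 2))"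
    by (simp add: ball_word_map[OF w])
  have mid: "word_map \<phi> w ((c + d) / 2) = (word_map \<phi> w c + word_map \<phi> w d) / 2"
    using word_map_affine[OF w, of "(c + d) / 2"] word_map_affine[OF w, of c]
      word_map_affine[OF w, of d] by (simp add: field_simps)
  have rad: "\<bar>slope w\<bar> * ((d - c) / 2) = \<bar>word_map \<phi> w d - word_map \<phi> w c\<bar> / 2"
    using \<open>c < d\<close> by (simp add: abs_word_map_diff[OF w])
  have "y \<in> ball ((p + q) / 2) (\<bar>q - p\<bar> / 2) \<longleftrightarrow> y \<in> {min p q<..<max p q}" for y p q :: real
    unfolding mem_ball dist_real_def greaterThanLessThan_iff abs_less_iff min_def max_def
    by (cases "p \<le> q") (auto simp: field_simps)
  then show ?thesis unfolding im mid rad by blast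
qed

section \<open>Cylinders of a feasible open set\<close>

lemma feasible_word_map_subset:
  assumes "feasible_open_set N \<phi> V" "w \<in> words N"
  shows "word_map \<phi> w ` V \<subseteq> V"
  using assms(2)
proof (induction w)
  case (Cons i w)
  then have "word_map \<phi> w ` V \<subseteq> V" "\<phi> i ` V \<subseteq> V"
    using assms(1) by (auto simp: feasible_open_set_def words_iff)
  then show ?case by auto
qed simp

text \<open>
  After the common prefix is cancelled by injectivity, the images lie in \<open>\<phi>\<^sub>b(V)\<close> and \<open>\<phi>\<^sub>c(V)\<close> for the
  first letters \<open>b \<noteq> c\<close> in which the words differ.
\<close>

lemma feasible_parallel_disjoint:
  assumes V: "feasible_open_set N \<phi> V" and v: "v \<in> words N" and w: "w \<in> words N"
    and vw: "v \<parallel> w"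
  shows "word_map \<phi> v ` V \<inter> word_map \<phi> w ` V = {}"
proof -
  obtain as b bs c cs where bc: "b \<noteq> c" and v_eq: "v = as @ b # bs" and w_eq: "w = as @ c # cs"
    using parallel_decomp[OF vw] by blast
  have mem: "as \<in> words N" "b \<in> {1..N}" "c \<in> {1..N}" "bs \<in> words N" "cs \<in> words N"
    using v w by (auto simp: v_eq w_eq words_iff)
  have sub: "word_map \<phi> bs ` V \<subseteq> V" "word_map \<phi> cs ` V \<subseteq> V"
    using feasible_word_map_subset[OF V] mem by auto
  have "\<phi> b ` V \<inter> \<phi> c ` V = {}"
    using V bc mem by (auto simp: feasible_open_set_def)
  moreover have "word_map \<phi> (b # bs) ` V \<subseteq> \<phi> b ` V" "word_map \<phi> (c # cs) ` V \<subseteq> \<phi> c ` V"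
    using sub by auto
  ultimately have "word_map \<phi> (b # bs) ` V \<inter> word_map \<phi> (c # cs) ` V = {}" by blast
  moreover have "word_map \<phi> v ` V = word_map \<phi> as ` word_map \<phi> (b # bs) ` V"
    "word_map \<phi> w ` V = word_map \<phi> as ` word_map \<phi> (c # cs) ` V"
    unfolding v_eq w_eq image_image word_map_append by (rule refl)+
  ultimately show ?thesis
    using image_Int[OF inj_word_map[OF mem(1)], of "word_map \<phi> (b # bs) ` V" "word_map \<phi> (c # cs) ` V"]
    by simp
qed

lemma subset_orbit: "G \<subseteq> (\<Union>w\<in>words N. word_map \<phi> w ` G)"
  by (rule UN_upper[of "[]", THEN subset_trans[rotated]]) (simp_all add: words_iff)

text \<open>
  Feasible sets will be built as orbits under the word maps: these are invariant for free, and since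
  \<open>\<phi>\<^sub>i\<close> takes the orbit to its words starting with \<open>i\<close>, only copies of \<open>G\<close> whose words differ in the
  first letter have to be kept apart.
\<close>

lemma feasible_orbit:
  assumes G: "open G" "G \<noteq> {}"
    and disj: "\<And>i j v w. \<lbrakk>i \<in> {1..N}; j \<in> {1..N}; i \<noteq> j; v \<in> words N; w \<in> words N\<rbrakk>
      \<Longrightarrow> word_map \<phi> (i # v) ` G \<inter> word_map \<phi> (j # w) ` G = {}"
  shows "feasible_open_set N \<phi> (\<Union>w\<in>words N. word_map \<phi> w ` G)"
  unfolding feasible_open_set_def
proof (intro conjI ballI impI)
  let ?U = "\<Union>w\<in>words N. word_map \<phi> w ` G"
  have Nil: "[] \<in> words N" by (simp add: words_iff)
  show "open ?U" using open_word_map_image G by blast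
  show "?U \<noteq> {}" using G Nil by blast
  have im: "\<phi> i ` ?U = (\<Union>w\<in>words N. word_map \<phi> (i # w) ` G)" for i
    by (auto simp: image_UN image_image)
  show "\<phi> i ` ?U \<subseteq> ?U" if "i \<in> {1..N}" for i
  proof -
    have "i # w \<in> words N" if "w \<in> words N" for w
      using that \<open>i \<in> {1..N}\<close> by (simp add: words_iff)
    then show ?thesis unfolding im by blast
  qed
  show "\<phi> i ` ?U \<inter> \<phi> j ` ?U = {}" if "i \<in> {1..N}" "j \<in> {1..N}" "i \<noteq> j" for i j
  proof -
    have UN_disjoint: "(\<Union>w\<in>words N. A w) \<inter> (\<Union>w\<in>words N. B w) = {}"
      if "\<And>v w. v \<in> words N \<Longrightarrow> w \<in> words N \<Longrightarrow> A v \<inter> B w = {}" for A B :: "nat list \<Rightarrow> real set"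
      using that by blast
    show ?thesis unfolding im by (rule UN_disjoint) (rule disj[OF that])
  qed
qed

end

section \<open>Neighbours of a cylinder\<close>

locale affine_ifs_attractor = affine_ifs +
  fixes F :: "real set"
  assumes attractor: "self_similar_set N \<phi> F"
begin

lemma compact_F: "compact F" and F_nonempty: "F \<noteq> {}"
  and F_eq: "F = (\<Union>i\<in>{1..N}. \<phi> i ` F)"
  using attractor by (simp_all add: self_similar_set_def)

lemma word_map_in_F: "w \<in> words N \<Longrightarrow> x \<in> F \<Longrightarrow> word_map \<phi> w x \<in> F"
proof (induction w)
  case (Cons i w)
  then have "word_map \<phi> w x \<in> F" "i \<in> {1..N}" by (auto simp: words_iff)
  then have "\<phi> i (word_map \<phi> w x) \<in> (\<Union>i\<in>{1..N}. \<phi> i ` F)" by blast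
  then show ?case unfolding F_eq[symmetric] by simp
qed simp

text \<open>
  The neighbours of \<open>\<kappa>\<close> are taken from the cut set of words at which the contraction ratio first
  drops to that of \<open>\<kappa>\<close>; members of a cut set are pairwise incomparable.
\<close>

definition neighbours :: "real \<Rightarrow> nat list \<Rightarrow> nat list set" where
  "neighbours p \<kappa> = {v \<in> words N. v \<noteq> [] \<and> \<bar>slope v\<bar> \<le> \<bar>slope \<kappa>\<bar> \<and> \<bar>slope \<kappa>\<bar> < \<bar>slope (butlast v)\<bar> \<and>
     (\<exists>y\<in>F. \<bar>word_map \<phi> v y - word_map \<phi> \<kappa> p\<bar> \<le> \<bar>slope \<kappa>\<bar>)}"

lemma neighbours_append:
  assumes w: "w \<in> words N" and k: "\<kappa> \<in> words N"
  shows "(@) w ` neighbours p \<kappa> \<subseteq> neighbours p (w @ \<kappa>)"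
proof
  fix u assume "u \<in> (@) w ` neighbours p \<kappa>"
  then obtain v where u: "u = w @ v" and v: "v \<in> neighbours p \<kappa>" by blast
  have "\<bar>word_map \<phi> (w @ v) y - word_map \<phi> (w @ \<kappa>) p\<bar>
      = \<bar>slope w\<bar> * \<bar>word_map \<phi> v y - word_map \<phi> \<kappa> p\<bar>" for y
    by (simp add: word_map_append abs_word_map_diff[OF w])
  then show "u \<in> neighbours p (w @ \<kappa>)"
    using v slope_word_pos[OF w] w unfolding u
    by (auto simp: neighbours_def words_iff butlast_append abs_mult)
qed

lemma neighbours_parallel:
  assumes v: "v \<in> neighbours p \<kappa>" and w: "w \<in> neighbours p \<kappa>" and "v \<noteq> w"
  shows "v \<parallel> w"
proof -
  have False if vw: "v \<in> neighbours p \<kappa>" "w \<in> neighbours p \<kappa>" "prefix v w" "v \<noteq> w" for v w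
  proof -
    obtain t where t: "w = v @ t" "t \<noteq> []" using \<open>prefix v w\<close> \<open>v \<noteq> w\<close> by (auto simp: prefix_def)
    then have "butlast t \<in> words N"
      using vw(2) by (auto simp: neighbours_def words_iff dest: in_set_butlastD)
    then have "\<bar>slope v\<bar> * \<bar>slope (butlast t)\<bar> \<le> \<bar>slope v\<bar> * 1"
      by (intro mult_left_mono slope_word_le_1) auto
    then show False using vw t by (auto simp: neighbours_def butlast_append abs_mult)
  qed
  then show ?thesis using assms by (auto simp: parallel_def)
qed

text \<open>
  Packing: the open set condition supplies a point \<open>x\<^sub>0\<close> whose copies \<open>\<phi>\<^sub>v(x\<^sub>0)\<close>, for \<open>v\<close> a neighbour of
  \<open>\<kappa>\<close>, are separated by a fixed multiple of the scale of \<open>\<kappa>\<close>, while all of them lie within another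
  fixed multiple of that scale from \<open>\<phi>\<^sub>\<kappa>(p)\<close>.  Measured in units of the separation, their positions
  have different integer parts in a fixed range.
\<close>

lemma card_neighbours_bounded:
  assumes V: "feasible_open_set N \<phi> V"
  obtains M where "\<And>\<kappa>. \<kappa> \<in> words N \<Longrightarrow> finite (neighbours p \<kappa>) \<and> card (neighbours p \<kappa>) \<le> M"
proof -
  obtain x0 \<delta> where \<delta>: "0 < \<delta>" "ball x0 \<delta> \<subseteq> V"
    using V unfolding feasible_open_set_def by (metis ex_in_conv openE)
  obtain D where D: "\<And>y. y \<in> F \<Longrightarrow> \<bar>x0 - y\<bar> \<le> D"
    using compact_imp_bounded[OF compact_F] bounded_any_center[of F x0]
    by (auto simp: dist_real_def)
  define c where "c = Min ((\<lambda>i. \<bar>a i\<bar>) ` {1..N})"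
  have c_le: "c \<le> \<bar>a i\<bar>" if "i \<in> {1..N}" for i unfolding c_def using that by simp
  have c0: "0 < c" unfolding c_def using two_le_N slope_pos by (subst Min_gr_iff) auto
  define L where "L = \<lceil>(D + 1) / (c * \<delta>)\<rceil>"
  have "finite (neighbours p \<kappa>) \<and> card (neighbours p \<kappa>) \<le> card {-L..L}" if k: "\<kappa> \<in> words N" for \<kappa>
  proof -
    define s where "s = \<bar>slope \<kappa>\<bar>"
    have s0: "0 < s" using slope_word_pos[OF k] by (simp add: s_def)
    \<comment> \<open>The last letter of \<open>v\<close> took the slope below \<open>s\<close>, so it cannot have dropped by more than a factor \<open>c\<close>.\<close>
    have large: "c * s < \<bar>slope v\<bar>" if v: "v \<in> neighbours p \<kappa>" for v
    proof -
      have "v = butlast v @ [last v]" and vw: "v \<in> words N" using v by (auto simp: neighbours_def)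
      then have "slope v = slope (butlast v) * a (last v)" by (metis slope_append slope_Cons slope_Nil mult.right_neutral)
      moreover have "last v \<in> {1..N}" using v by (force simp: neighbours_def words_iff)
      ultimately show ?thesis
        using c_le[of "last v"] v c0 s0 mult_le_less_imp_less[of c "\<bar>a (last v)\<bar>" s "\<bar>slope (butlast v)\<bar>"]
        by (auto simp: neighbours_def s_def abs_mult mult.commute)
    qed
    \<comment> \<open>\<open>\<phi>\<^sub>v(V)\<close> contains a ball of radius \<open>\<bar>slope v\<bar> * \<delta>\<close> about \<open>\<phi>\<^sub>v(x\<^sub>0)\<close>, and \<open>\<phi>\<^sub>w(V)\<close> is disjoint from it.\<close>
    have separated: "c * s * \<delta> < \<bar>word_map \<phi> v x0 - word_map \<phi> w x0\<bar>"
      if v: "v \<in> neighbours p \<kappa>" and w: "w \<in> neighbours p \<kappa>" and "v \<noteq> w" for v w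
    proof -
      have vw: "v \<in> words N" "w \<in> words N" using v w by (auto simp: neighbours_def)
      have "word_map \<phi> w x0 \<notin> word_map \<phi> v ` V"
        using feasible_parallel_disjoint[OF V vw neighbours_parallel[OF that]] \<delta>
        by (metis centre_in_ball disjoint_iff image_eqI subsetD)
      then have "word_map \<phi> w x0 \<notin> ball (word_map \<phi> v x0) (\<bar>slope v\<bar> * \<delta>)"
        using ball_word_map[OF vw(1)] \<delta>(2) by blast
      then have "\<bar>slope v\<bar> * \<delta> \<le> \<bar>word_map \<phi> v x0 - word_map \<phi> w x0\<bar>"
        by (simp add: dist_real_def)
      moreover have "c * s * \<delta> < \<bar>slope v\<bar> * \<delta>" using large[OF v] \<delta>(1) by simp
      ultimately show ?thesis by linarith
    qed
    have near: "\<bar>word_map \<phi> v x0 - word_map \<phi> \<kappa> p\<bar> \<le> s * (D + 1)" if v: "v \<in> neighbours p \<kappa>" for v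
    proof -
      obtain y where y: "y \<in> F" "\<bar>word_map \<phi> v y - word_map \<phi> \<kappa> p\<bar> \<le> s"
        and vw: "v \<in> words N" "\<bar>slope v\<bar> \<le> s"
        using v by (auto simp: neighbours_def s_def)
      have "\<bar>word_map \<phi> v x0 - word_map \<phi> v y\<bar> \<le> s * D"
        unfolding abs_word_map_diff[OF vw(1)] using vw(2) D[OF y(1)] s0 by (intro mult_mono) auto
      with y(2) show ?thesis by (simp add: algebra_simps)
    qed
    define g where "g v = \<lfloor>(word_map \<phi> v x0 - word_map \<phi> \<kappa> p) / (c * s * \<delta>)\<rfloor>" for v
    have unit: "0 < c * s * \<delta>" using c0 s0 \<delta>(1) by simp
    have "inj_on g (neighbours p \<kappa>)"
    proof (rule inj_onI, rule ccontr)
      fix v w assume vw: "v \<in> neighbours p \<kappa>" "w \<in> neighbours p \<kappa>" "g v = g w" "v \<noteq> w"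
      let ?q = "\<lambda>v. (word_map \<phi> v x0 - word_map \<phi> \<kappa> p) / (c * s * \<delta>)"
      have "\<bar>?q v - ?q w\<bar> < 1" using vw(3) unfolding g_def by linarith
      moreover have "?q v - ?q w = (word_map \<phi> v x0 - word_map \<phi> w x0) / (c * s * \<delta>)"
        by (simp add: diff_divide_distrib)
      ultimately have "\<bar>word_map \<phi> v x0 - word_map \<phi> w x0\<bar> < c * s * \<delta>"
        using unit by (simp add: abs_divide)
      with separated[OF vw(1,2,4)] show False by simp
    qed
    moreover have "g ` neighbours p \<kappa> \<subseteq> {-L..L}"
    proof
      fix k assume "k \<in> g ` neighbours p \<kappa>"
      then obtain v where v: "v \<in> neighbours p \<kappa>" "k = g v" by blast
      have "\<bar>(word_map \<phi> v x0 - word_map \<phi> \<kappa> p) / (c * s * \<delta>)\<bar> \<le> s * (D + 1) / (c * s * \<delta>)"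
        unfolding abs_divide abs_of_pos[OF unit] using near[OF v(1)] unit
        by (intro divide_right_mono) simp_all
      also have "\<dots> = (D + 1) / (c * \<delta>)" using s0 by simp
      also have "\<dots> \<le> L" by (simp add: L_def)
      finally have "\<bar>(word_map \<phi> v x0 - word_map \<phi> \<kappa> p) / (c * s * \<delta>)\<bar> \<le> of_int L" .
      moreover have "\<lfloor>t\<rfloor> \<in> {-L..L}" if "\<bar>t\<bar> \<le> of_int L" for t :: real
        using that unfolding atLeastAtMost_iff le_floor_iff floor_le_iff of_int_minus by linarith
      ultimately show "k \<in> {-L..L}" unfolding v(2) g_def by blast
    qed
    ultimately show ?thesis
      using card_inj_on_le[of g "neighbours p \<kappa>" "{-L..L}"] inj_on_finite[of g "neighbours p \<kappa>" "{-L..L}"]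
      by simp
  qed
  with that show thesis by blast
qed

text \<open>
  Each further letter shrinks the slope, which starts above \<open>s\<close> at the empty word, so some shortest
  prefix takes it down to \<open>s\<close>.
\<close>

lemma cut_prefix:
  assumes "w \<in> words N" "\<bar>slope w\<bar> \<le> s" "s < 1"
  obtains v t where "w = v @ t" "v \<noteq> []" "\<bar>slope v\<bar> \<le> s" "s < \<bar>slope (butlast v)\<bar>"
proof -
  have "\<exists>v t. w = v @ t \<and> v \<noteq> [] \<and> \<bar>slope v\<bar> \<le> s \<and> s < \<bar>slope (butlast v)\<bar>"
    using assms
  proof (induction w rule: rev_induct)
    case Nil
    then show ?case by simp
  next
    case (snoc i w)
    show ?case
    proof (cases "\<bar>slope w\<bar> \<le> s")
      case True
      have "w \<in> words N" using snoc.prems by (simp add: words_iff)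
      from snoc.IH[OF this True snoc.prems(3)] obtain v t
        where "w = v @ t" "v \<noteq> []" "\<bar>slope v\<bar> \<le> s" "s < \<bar>slope (butlast v)\<bar>" by blast
      then show ?thesis by (intro exI[of _ v] exI[of _ "t @ [i]"]) simp
    next
      case False
      then show ?thesis using snoc.prems(2) by (intro exI[of _ "w @ [i]"] exI[of _ "[]"]) simp
    qed
  qed
  with that show thesis by blast
qed

section \<open>Strong feasible open sets\<close>

text \<open>
  The word \<open>\<kappa>\<close> is chosen with the maximal number of neighbours, so that prefixing cannot create new
  ones.  The radius of the ball \<open>G\<close> is half the distance within which neighbours are sought: two
  copies of \<open>G\<close> that meet have centres closer than the larger of the two scales.
\<close>

lemma strong_feasible_open_set_exists:
  assumes V: "feasible_open_set N \<phi> V"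
  obtains W where "feasible_open_set N \<phi> W" "strong_set F W"
proof -
  obtain p where p: "p \<in> F" using F_nonempty by blast
  obtain M where M: "\<And>\<kappa>. \<kappa> \<in> words N \<Longrightarrow> finite (neighbours p \<kappa>) \<and> card (neighbours p \<kappa>) \<le> M"
    using card_neighbours_bounded[OF V] by blast
  have "[] \<in> words N" by (simp add: words_iff)
  then obtain \<kappa> where k: "\<kappa> \<in> words N"
    and max: "\<And>w. w \<in> words N \<Longrightarrow> card (neighbours p w) \<le> card (neighbours p \<kappa>)"
    using ex_has_greatest_nat[of "\<lambda>w. w \<in> words N" "[]" "\<lambda>w. card (neighbours p w)" "Suc M"] M
    by (metis le_imp_less_Suc less_imp_le)
  have saturated: "neighbours p (w @ \<kappa>) = (@) w ` neighbours p \<kappa>" if w: "w \<in> words N" for w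
  proof -
    have wk: "w @ \<kappa> \<in> words N" using w k by (simp add: words_iff)
    have "card ((@) w ` neighbours p \<kappa>) = card (neighbours p \<kappa>)"
      by (rule card_image) (simp add: inj_on_def)
    then show ?thesis
      using neighbours_append[OF w k] M[OF wk] max[OF wk] card_seteq by metis
  qed
  \<comment> \<open>If the two points came too close, truncating \<open>j # w @ \<kappa>\<close> to the cut set of \<open>i # v @ \<kappa>\<close>
     would give a neighbour of \<open>i # v @ \<kappa>\<close> with first letter \<open>j\<close>.\<close>
  have apart: "\<bar>slope (i # v @ \<kappa>)\<bar> < \<bar>word_map \<phi> (j # w @ \<kappa>) p - word_map \<phi> (i # v @ \<kappa>) p\<bar>"
    if ij: "i \<in> {1..N}" "j \<in> {1..N}" "i \<noteq> j" and vw: "v \<in> words N" "w \<in> words N"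
      and le: "\<bar>slope (j # w @ \<kappa>)\<bar> \<le> \<bar>slope (i # v @ \<kappa>)\<bar>" for i j v w
  proof (rule ccontr)
    assume close: "\<not> ?thesis"
    have ws: "i # v @ \<kappa> \<in> words N" "j # w @ \<kappa> \<in> words N" "i # v \<in> words N"
      using ij vw k by (auto simp: words_iff)
    obtain x t where xt: "j # w @ \<kappa> = x @ t" "x \<noteq> []" "\<bar>slope x\<bar> \<le> \<bar>slope (i # v @ \<kappa>)\<bar>"
      "\<bar>slope (i # v @ \<kappa>)\<bar> < \<bar>slope (butlast x)\<bar>"
      using cut_prefix[OF ws(2) le slope_Cons_less_1[OF ws(1)]] by blast
    have "x \<in> words N" "t \<in> words N" using ws(2) unfolding xt(1) by (auto simp: words_iff)
    moreover have "\<bar>word_map \<phi> x (word_map \<phi> t p) - word_map \<phi> (i # v @ \<kappa>) p\<bar> \<le> \<bar>slope (i # v @ \<kappa>)\<bar>"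
      using close unfolding xt(1) word_map_append by simp
    ultimately have "x \<in> neighbours p (i # v @ \<kappa>)"
      using xt(2-4) word_map_in_F[OF _ p] unfolding neighbours_def by blast
    then have "x \<in> (@) (i # v) ` neighbours p \<kappa>" using saturated[OF ws(3)] by simp
    then have "hd x = i" by auto
    moreover have "hd x = j" using xt(1,2) by (metis hd_append2 list.sel(1))
    ultimately show False using ij(3) by simp
  qed
  define R where "R = \<bar>slope \<kappa>\<bar>"
  define G where "G = ball (word_map \<phi> \<kappa> p) (R / 2)"
  have R0: "0 < R" using slope_word_pos[OF k] by (simp add: R_def)
  have G_mem: "word_map \<phi> \<kappa> p \<in> G" using R0 by (simp add: G_def)
  have "feasible_open_set N \<phi> (\<Union>w\<in>words N. word_map \<phi> w ` G)"
  proof (rule feasible_orbit)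
    show "open G" by (simp add: G_def)
    show "G \<noteq> {}" using G_mem by blast
    fix i j v w
    assume ij: "i \<in> {1..N}" "j \<in> {1..N}" "i \<noteq> j" and vw: "v \<in> words N" "w \<in> words N"
    have im: "word_map \<phi> u ` G = ball (word_map \<phi> (u @ \<kappa>) p) (\<bar>slope (u @ \<kappa>)\<bar> / 2)"
      if "u \<in> words N" for u
      unfolding G_def R_def ball_word_map[OF that] by (simp add: word_map_append abs_mult)
    let ?x = "word_map \<phi> (i # v @ \<kappa>) p" and ?y = "word_map \<phi> (j # w @ \<kappa>) p"
    have average_le: "(r + t) / 2 \<le> x" if "t \<le> r" "r < x" for r t x :: real
      using that by (simp add: field_simps)
    have "(\<bar>slope (i # v @ \<kappa>)\<bar> + \<bar>slope (j # w @ \<kappa>)\<bar>) / 2 \<le> \<bar>?y - ?x\<bar>"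
    proof (cases "\<bar>slope (j # w @ \<kappa>)\<bar> \<le> \<bar>slope (i # v @ \<kappa>)\<bar>")
      case True
      show ?thesis by (rule average_le[OF True apart[OF ij vw True]])
    next
      case False
      then have ge: "\<bar>slope (i # v @ \<kappa>)\<bar> \<le> \<bar>slope (j # w @ \<kappa>)\<bar>" by simp
      show ?thesis
        unfolding abs_minus_commute[of ?y] add.commute[of "\<bar>slope (i # v @ \<kappa>)\<bar>"]
        by (rule average_le[OF ge apart[OF ij(2,1) ij(3)[symmetric] vw(2,1) ge]])
    qed
    then have "ball ?x (\<bar>slope (i # v @ \<kappa>)\<bar> / 2) \<inter> ball ?y (\<bar>slope (j # w @ \<kappa>)\<bar> / 2) = {}"
      by (intro disjoint_ballI) (simp add: dist_real_def add_divide_distrib abs_minus_commute)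
    moreover have "i # v \<in> words N" "j # w \<in> words N" using ij vw by (auto simp: words_iff)
    ultimately show "word_map \<phi> (i # v) ` G \<inter> word_map \<phi> (j # w) ` G = {}"
      by (simp only: im append_Cons)
  qed
  moreover have "word_map \<phi> \<kappa> p \<in> (\<Union>w\<in>words N. word_map \<phi> w ` G) \<inter> F"
    using word_map_in_F[OF k p] G_mem subset_orbit by blast
  ultimately show thesis using that unfolding strong_set_def by blast
qed

section \<open>The central interval\<close>

text \<open>
  If \<open>F\<close> were a single point, it would be a common fixed point of all maps, and similarities of the
  line with a common fixed point commute; but \<open>\<phi>\<^sub>1 \<phi>\<^sub>2\<close> and \<open>\<phi>\<^sub>2 \<phi>\<^sub>1\<close> have disjoint images of a feasible set.
\<close>

lemma F_not_singleton:
  assumes V: "feasible_open_set N \<phi> V"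
  shows "F \<noteq> {p}"
proof
  assume F: "F = {p}"
  have i: "1 \<in> {1..N}" "2 \<in> {1..N}" using two_le_N by auto
  have fixed: "\<phi> i p = p" if "i \<in> {1..N}" for i using F_eq that unfolding F by blast
  have lin: "\<phi> i x = a i * (x - p) + p" if "i \<in> {1..N}" for i x
    using affine[OF that, of x] affine[OF that, of p] fixed[OF that] by (simp add: algebra_simps)
  obtain x where x: "x \<in> V" using V by (auto simp: feasible_open_set_def)
  have "\<phi> 1 (\<phi> 2 x) = \<phi> 2 (\<phi> 1 x)"
    unfolding lin[OF i(1)] lin[OF i(2)] by simp
  moreover have "\<phi> 1 ` V \<subseteq> V" "\<phi> 2 ` V \<subseteq> V"
    using V i unfolding feasible_open_set_def by blast+
  then have "\<phi> 1 x \<in> V" "\<phi> 2 x \<in> V" using x by blast+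
  moreover have "(1::nat) \<noteq> 2" by simp
  then have "\<phi> 1 ` V \<inter> \<phi> 2 ` V = {}"
    using V i unfolding feasible_open_set_def by blast
  ultimately show False by (metis disjoint_iff image_eqI)
qed

lemma central_interval_eq:
  assumes V: "feasible_open_set N \<phi> V"
  obtains c d where "c \<in> F" "d \<in> F" "c < d" "F \<subseteq> {c..d}" "central_interval F = {c<..<d}"
proof -
  obtain c where c: "c \<in> F" "\<And>x. x \<in> F \<Longrightarrow> c \<le> x"
    using compact_attains_inf[OF compact_F F_nonempty] by blast
  obtain d where d: "d \<in> F" "\<And>x. x \<in> F \<Longrightarrow> x \<le> d"
    using compact_attains_sup[OF compact_F F_nonempty] by blast
  have "c \<noteq> d"
  proof
    assume "c = d"
    then have "x = c" if "x \<in> F" for x using c(2)[OF that] d(2)[OF that] by simp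
    then have "F = {c}" using c(1) by blast
    with F_not_singleton[OF V] show False by blast
  qed
  with c(2)[OF d(1)] have cd: "c < d" by simp
  have "convex hull F = {c..d}"
  proof
    show "convex hull F \<subseteq> {c..d}" using c d by (intro hull_minimal) (auto simp: convex_real_interval)
    have "closed_segment c d \<subseteq> convex hull F"
      using c(1) d(1) by (intro closed_segment_subset_convex_hull) (auto simp: hull_inc)
    then show "{c..d} \<subseteq> convex hull F" using cd by (simp add: closed_segment_eq_real_ivl)
  qed
  then have "central_interval F = {c<..<d}" by (simp add: central_interval_def)
  moreover have "F \<subseteq> {c..d}" using c(2) d(2) by auto
  ultimately show thesis using that c(1) d(1) cd by blast
qed

text \<open>
  Otherwise \<open>F\<close> consists of the two end points of its hull, and the images of these under \<open>\<phi>\<^sub>1\<close> are two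
  distinct points of \<open>F\<close> that are strictly closer together.
\<close>

lemma central_interval_meets_F:
  assumes V: "feasible_open_set N \<phi> V"
  shows "central_interval F \<inter> F \<noteq> {}"
proof
  assume empty: "central_interval F \<inter> F = {}"
  obtain c d where cd: "c \<in> F" "d \<in> F" "c < d" "F \<subseteq> {c..d}" "central_interval F = {c<..<d}"
    by (rule central_interval_eq[OF V])
  then have F: "x = c \<or> x = d" if "x \<in> F" for x
    using empty that by (metis atLeastAtMost_iff disjoint_iff greaterThanLessThan_iff less_eq_real_def subsetD)
  have i: "1 \<in> {1..N}" using two_le_N by auto
  have im: "\<phi> 1 c \<in> F" "\<phi> 1 d \<in> F" using cd F_eq i by blast+
  have diff: "\<bar>\<phi> 1 c - \<phi> 1 d\<bar> = \<bar>a 1\<bar> * (d - c)"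
    using abs_word_map_diff[of "[1]" c d] i cd(3) by (simp add: words_iff)
  have "0 < \<bar>\<phi> 1 c - \<phi> 1 d\<bar>" "\<bar>\<phi> 1 c - \<phi> 1 d\<bar> < d - c"
    unfolding diff using slope_pos[OF i] slope_less_1[OF i] cd(3) by simp_all
  with F[OF im(1)] F[OF im(2)] cd(3) show False by auto
qed

section \<open>Compatibility\<close>

text \<open>
  An open interval with end points outside a ball either misses the ball or contains all of it, in
  particular its centre.
\<close>

lemma (in -) frontier_Union_intervals:
  fixes \<J> :: "real set set"
  assumes C: "closed C"
    and J: "\<And>J. J \<in> \<J> \<Longrightarrow> \<exists>c\<in>C. \<exists>d\<in>C. J = {c<..<d}"
  shows "frontier (\<Union>\<J>) \<subseteq> C"
proof
  fix x assume x: "x \<in> frontier (\<Union>\<J>)"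
  have "open (\<Union>\<J>)" using J by (metis open_Union open_greaterThanLessThan)
  with x have cl: "x \<in> closure (\<Union>\<J>)" and notin: "x \<notin> \<Union>\<J>"
    by (auto simp: frontier_def interior_open)
  show "x \<in> C"
  proof (rule ccontr)
    assume "x \<notin> C"
    then obtain e where e: "0 < e" "ball x e \<subseteq> - C"
      using C by (metis ComplI open_Compl openE)
    obtain y where y: "y \<in> \<Union>\<J>" "dist y x < e"
      using cl e(1) closure_approachable by blast
    then obtain c d where cd: "c \<in> C" "d \<in> C" "{c<..<d} \<in> \<J>" "c < y" "y < d"
      using J by (metis UnionE greaterThanLessThan_iff)
    then have "e \<le> \<bar>x - c\<bar>" "e \<le> \<bar>x - d\<bar>" using e(2) by (force simp: dist_real_def not_less)+
    then have "c < x" "x < d" using y(2) cd(4,5) by (auto simp: dist_real_def abs_if split: if_splits)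
    with cd(3) notin show False by auto
  qed
qed

text \<open>
  Cylinders shrink to points uniformly, so every point of \<open>F\<close> has cylinders in any neighbourhood.
\<close>

lemma small_cylinder:
  assumes x: "x \<in> F" and e: "0 < e"
  obtains w y where "w \<in> words N" "y \<in> F" "word_map \<phi> w y = x" "\<bar>slope w\<bar> < e"
proof -
  define q where "q = Max ((\<lambda>i. \<bar>a i\<bar>) ` {1..N})"
  have q: "\<bar>a i\<bar> \<le> q" if "i \<in> {1..N}" for i unfolding q_def using that by simp
  have "q < 1" unfolding q_def using two_le_N slope_less_1 by (subst Max_less_iff) auto
  have q0: "0 \<le> q" using q[of 1] two_le_N by auto
  have "\<exists>w y. w \<in> words N \<and> y \<in> F \<and> word_map \<phi> w y = z \<and> \<bar>slope w\<bar> \<le> q ^ n" if "z \<in> F" for n z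
    using that
  proof (induction n arbitrary: z)
    case 0
    then show ?case by (intro exI[of _ "[]"]) (auto simp: words_iff)
  next
    case (Suc n)
    obtain i z' where i: "i \<in> {1..N}" "z' \<in> F" "z = \<phi> i z'" using Suc.prems F_eq by blast
    obtain w y where w: "w \<in> words N" "y \<in> F" "word_map \<phi> w y = z'" "\<bar>slope w\<bar> \<le> q ^ n"
      using Suc.IH[OF i(2)] by blast
    have "\<bar>slope (i # w)\<bar> \<le> q ^ Suc n" using q[OF i(1)] w(4) q0 by (auto simp: abs_mult intro: mult_mono)
    with i w show ?case by (intro exI[of _ "i # w"] exI[of _ y]) (auto simp: words_iff)
  qed
  moreover obtain n where "q ^ n < e" using real_arch_pow_inv[OF e \<open>q < 1\<close>] by blast
  ultimately show thesis using that x by (meson le_less_trans)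
qed

lemma generated_set_single:
  "generated_set N \<phi> F {u} = (\<Union>w\<in>words N. word_map \<phi> w ` word_map \<phi> u ` central_interval F)"
  by (simp add: generated_set_def)

lemma compatible_generated_set:
  assumes V: "feasible_open_set N \<phi> V" and u: "u \<in> words N"
  shows "compatible_set F (generated_set N \<phi> F {u})"
proof -
  obtain c d where cd: "c \<in> F" "d \<in> F" "c < d" "central_interval F = {c<..<d}"
    by (rule central_interval_eq[OF V])
  define \<J> where "\<J> = (\<lambda>w. word_map \<phi> (w @ u) ` {c<..<d}) ` words N"
  have "frontier (\<Union>\<J>) \<subseteq> F"
  proof (rule frontier_Union_intervals[OF compact_imp_closed[OF compact_F]])
    fix J assume "J \<in> \<J>"
    then obtain w where w: "w \<in> words N" "J = word_map \<phi> (w @ u) ` {c<..<d}"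
      by (auto simp: \<J>_def)
    have wu: "w @ u \<in> words N" using w u by (simp add: words_iff)
    have "word_map \<phi> (w @ u) c \<in> F" "word_map \<phi> (w @ u) d \<in> F"
      using word_map_in_F[OF wu] cd(1,2) by simp_all
    then have "min (word_map \<phi> (w @ u) c) (word_map \<phi> (w @ u) d) \<in> F"
      "max (word_map \<phi> (w @ u) c) (word_map \<phi> (w @ u) d) \<in> F"
      by (simp_all add: min_def max_def)
    then show "\<exists>c\<in>F. \<exists>d\<in>F. J = {c<..<d}"
      unfolding w(2) word_map_interval[OF wu cd(3)] by blast
  qed
  moreover have "\<Union>\<J> = generated_set N \<phi> F {u}"
    by (simp add: generated_set_single \<J>_def cd(4) image_image word_map_append)
  ultimately show ?thesis by (simp add: compatible_set_def)
qed

text \<open>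
  A cylinder interval inside \<open>W\<close> exists near any point of \<open>W \<inter> F\<close>; its orbit stays in the feasible set
  \<open>W\<close>, which keeps the copies with different first letters disjoint.
\<close>

lemma good_generated_set_exists:
  assumes W: "feasible_open_set N \<phi> W" and strong: "strong_set F W"
  obtains u where "u \<in> words N" "feasible_open_set N \<phi> (generated_set N \<phi> F {u})"
    "strong_set F (generated_set N \<phi> F {u})" "compatible_set F (generated_set N \<phi> F {u})"
proof -
  obtain c d where cd: "c \<in> F" "d \<in> F" "c < d" "F \<subseteq> {c..d}" "central_interval F = {c<..<d}"
    by (rule central_interval_eq[OF W])
  obtain x e where x: "x \<in> F" and e: "0 < e" "ball x e \<subseteq> W"
    using strong W unfolding strong_set_def feasible_open_set_def by (metis disjoint_iff openE)
  have "0 < e / (d - c)" using e cd by simp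
  from small_cylinder[OF x this] obtain u y
    where u: "u \<in> words N" "y \<in> F" "word_map \<phi> u y = x" "\<bar>slope u\<bar> < e / (d - c)" by blast
  define G where "G = word_map \<phi> u ` central_interval F"
  have GW: "G \<subseteq> W"
  proof
    fix g assume "g \<in> G"
    then obtain z where z: "g = word_map \<phi> u z" "c < z" "z < d" by (auto simp: G_def cd(5))
    have "c \<le> y" "y \<le> d" using u(2) cd(4) by auto
    have "\<bar>x - g\<bar> = \<bar>slope u\<bar> * \<bar>y - z\<bar>" using abs_word_map_diff[OF u(1), of y z] u(3) z(1) by simp
    also have "\<dots> \<le> \<bar>slope u\<bar> * (d - c)"
      using z \<open>c \<le> y\<close> \<open>y \<le> d\<close> by (intro mult_left_mono) auto
    also have "\<dots> < e" using u(4) cd(3) by (simp add: field_simps)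
    finally show "g \<in> W" using e(2) by (auto simp: dist_real_def)
  qed
  have gen: "generated_set N \<phi> F {u} = (\<Union>w\<in>words N. word_map \<phi> w ` G)"
    by (simp add: generated_set_single G_def)
  obtain z where z: "z \<in> central_interval F" "z \<in> F" using central_interval_meets_F[OF W] by blast
  have zG: "word_map \<phi> u z \<in> G" using z by (simp add: G_def)
  have "feasible_open_set N \<phi> (generated_set N \<phi> F {u})"
    unfolding gen
  proof (rule feasible_orbit)
    show "open G" unfolding G_def cd(5) by (rule open_word_map_image[OF u(1)]) simp
    show "G \<noteq> {}" using zG by blast
    fix i j v w
    assume ij: "i \<in> {1..N}" "j \<in> {1..N}" "i \<noteq> j" and vw: "v \<in> words N" "w \<in> words N"
    have "i # v \<parallel> j # w" using ij(3) by (simp add: parallel_def)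
    moreover have "i # v \<in> words N" "j # w \<in> words N" using ij vw by (auto simp: words_iff)
    ultimately have "word_map \<phi> (i # v) ` W \<inter> word_map \<phi> (j # w) ` W = {}"
      using feasible_parallel_disjoint[OF W] by blast
    with GW show "word_map \<phi> (i # v) ` G \<inter> word_map \<phi> (j # w) ` G = {}" by blast
  qed
  moreover have "word_map \<phi> u z \<in> generated_set N \<phi> F {u} \<inter> F"
    unfolding gen using zG word_map_in_F[OF u(1) z(2)] subset_orbit by blast
  ultimately show thesis
    using that u(1) compatible_generated_set[OF W u(1)] unfolding strong_set_def by blast
qed

end

section \<open>Existence of strong compatible feasible open sets\<close>

theorem theorem3p4:
  fixes N :: nat and \<phi> :: "nat \<Rightarrow> real \<Rightarrow> real" and F :: "real set"
  assumes "similarity_ifs N \<phi>"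
    and "open_set_condition N \<phi>"
    and "self_similar_set N \<phi> F"
  shows "(\<exists>U. feasible_open_set N \<phi> U \<and> strong_set F U \<and> compatible_set F U) \<and>
         (\<exists>m \<Lambda>. \<Lambda> \<subseteq> words_of_length N m \<and>
            feasible_open_set N \<phi> (generated_set N \<phi> F \<Lambda>) \<and>
            strong_set F (generated_set N \<phi> F \<Lambda>) \<and>
            compatible_set F (generated_set N \<phi> F \<Lambda>))"
proof -
  have "\<forall>i\<in>{1..N}. \<exists>a. 0 < \<bar>a\<bar> \<and> \<bar>a\<bar> < 1 \<and> (\<forall>x. \<phi> i x = a * x + \<phi> i 0)"
    using assms(1) contracting_similarity_affine unfolding similarity_ifs_def by metis
  then obtain a where
    a: "\<forall>i\<in>{1..N}. 0 < \<bar>a i\<bar> \<and> \<bar>a i\<bar> < 1 \<and> (\<forall>x. \<phi> i x = a i * x + \<phi> i 0)"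
    by (rule bchoice[THEN exE])
  interpret affine_ifs_attractor N \<phi> a F
  proof
    show "2 \<le> N" using assms(1) by (simp add: similarity_ifs_def)
    show "self_similar_set N \<phi> F" by (rule assms(3))
  qed (use a in blast)+
  obtain V where "feasible_open_set N \<phi> V" using assms(2) by (auto simp: open_set_condition_def)
  then obtain W where "feasible_open_set N \<phi> W" "strong_set F W"
    using strong_feasible_open_set_exists by blast
  then obtain u where u: "u \<in> words N" and good: "feasible_open_set N \<phi> (generated_set N \<phi> F {u})"
    "strong_set F (generated_set N \<phi> F {u})" "compatible_set F (generated_set N \<phi> F {u})"
    using good_generated_set_exists by blast
  have "{u} \<subseteq> words_of_length N (length u)" using u by (simp add: words_iff words_of_length_def)
  with good show ?thesis by blast
qed

end
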